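(* Let $X=\mathcal{A}^{\mathbb{Z}^d}$, $d\ge1$, with $\mathcal{A}$ a finite alphabet, let $\xi^t$ be a particle system on $X$ (a Markov chain with translation invariant transition probabilities), and let $X_r\subseteq X$ be a subset invariant with respect to the dynamics and with respect to spatial shifts. Let $L<\infty$. Suppose there exists a coupling of two copies $\xi^t,\acute\xi^t$ of the particle system such that for any two initial configurations $\xi^0,\acute\xi^0\in X_r$ we have, with probability one, $$\tilde\varrho(\xi^t,\sigma^\ell\acute\xi^t)\longrightarrow 0\quad\text{as } t\to\infty$$ for some $\ell\in\mathbb{Z}^d$ with $|\ell|<L$. Then there is at most one probability measure supported by $X_r$ that is both translation invariant in space and invariant (in time) for the Markov chain $\xi^t$.
   Context: $X=\mathcal{A}^{\mathbb{Z}^d}$ carries the product topology, metrized by $\varrho(x,y)=2^{-\kappa(x,y)}$, where $\kappa(x,y)$ is the largest $n$ with $x_\ell=y_\ell$ for all $|\ell|\le n$; here $|\ell|:=\max_i|\ell_i|$. $\mathcal{B}$ is the Borel sigma-algebra. The spatial shift by $\ell\in\mathbb{Z}^d$ is $(\sigma^\ell x)_i:=x_{i+\ell}$. A measure on $X$ is translation invariant (in space) if it is invariant under all $\sigma^\ell$. The particle system $\xi^t$ is a Markov chain on $X$ with transition probabilities $P^t(x,A)$ satisfying $P^t(x,A)=P^t(\sigma^\ell x,\sigma^\ell A)$ for all $x\in X$, $A\in\mathcal{B}$, $\ell\in\mathbb{Z}^d$. A measure $\mu$ is invariant (in time) if $P^t_*\mu=\mu$ for all $t$, where $P^t_*\mu(A)=\int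 P^t(x,A)\,d\mu(x)$. A set $Y\subseteq X$ is dynamically invariant if $\xi^0\in Y$ implies $\xi^t\in Y$ almost surely for every $t\ge0$. A coupling is a pairs process $(\xi^t,\acute\xi^t)$ on $X\times X$ whose law $\mathbb{P}_{x,y}$ depends measurably on the initial points $\xi^0=x$, $\acute\xi^0=y$, such that $\mathbb{P}_{x,y}(\xi^t\in A)=P^t(x,A)$ and $\mathbb{P}_{x,y}(\acute\xi^t\in A)=P^t(y,A)$ for all $t\ge0$, $A\in\mathcal{B}$ (not assumed Markovian). The semimetric $\tilde\varrho$ is the upper density of discrepancies: $$\tilde\varrho(x,y):=\limsup_{n\to\infty}\frac{\#\{k\in\mathbb{Z}^d:\ x_k\ne y_k,\ |k|\le n\}}{(2n+1)^d}.$$ *)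

theory Defs
  imports "HOL-Probability.Probability"
begin

(* Configurations: the lattice Z^d is int^'d with d = CARD('d) >= 1, and the alphabet is a finite
   type with the discrete topology, so that the function space instance of the class
   topological_space is the product topology and borel is its Borel sigma-algebra. *)
type_synonym ('a, 'd) config = "int ^ 'd \<Rightarrow> 'a"

definition lattice_norm :: "int ^ ('d::finite) \<Rightarrow> int" where
  "lattice_norm l = Max (range (\<lambda>i. \<bar>l $ i\<bar>))"

definition spatial_shift :: "int ^ ('d::finite) \<Rightarrow> ('a, 'd) config \<Rightarrow> ('a, 'd) config" where
  "spatial_shift l x = (\<lambda>i. x (i + l))"

definition upper_discrepancy :: "('a, 'd::finite) config \<Rightarrow> ('a, 'd) config \<Rightarrow> ereal" where
  "upper_discrepancy x y =
     limsup (\<lambda>n. ereal (real (card {k. x k \<noteq> y k \<and> lattice_norm k \<le> int n})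
                        / real ((2 * n + 1) ^ CARD('d))))"

(* Time is either discrete or continuous. *)
definition time_set :: "real set \<Rightarrow> bool" where
  "time_set T \<longleftrightarrow> T = \<nat> \<or> T = {0..}"

definition particle_system ::
  "real set \<Rightarrow> (real \<Rightarrow> ('a::{finite, discrete_topology}, 'd::finite) config \<Rightarrow> ('a, 'd) config measure) \<Rightarrow> bool"
where
  "particle_system T P \<longleftrightarrow>
     (\<forall>t\<in>T. P t \<in> borel \<rightarrow>\<^sub>M prob_algebra borel) \<and>
     (\<forall>x. P 0 x = return borel x) \<and>
     (\<forall>s\<in>T. \<forall>t\<in>T. \<forall>x. P (s + t) x = P s x \<bind> P t) \<and>
     (\<forall>t\<in>T. \<forall>x l. \<forall>A\<in>sets borel. emeasure (P t x) A = emeasure (P t (spatial_shift l x)) (spatial_shift l ` A))"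

(* Y need not be Borel: AE says that the complement of Y lies in a Borel null set. *)
definition dynamically_invariant ::
  "real set \<Rightarrow> (real \<Rightarrow> ('a, 'd::finite) config \<Rightarrow> ('a, 'd) config measure) \<Rightarrow> ('a, 'd) config set \<Rightarrow> bool"
where
  "dynamically_invariant T P Y \<longleftrightarrow> (\<forall>x\<in>Y. \<forall>t\<in>T. AE y in P t x. y \<in> Y)"

definition shift_invariant_set :: "('a, 'd::finite) config set \<Rightarrow> bool" where
  "shift_invariant_set Y \<longleftrightarrow> (\<forall>l. spatial_shift l ` Y = Y)"

definition time_invariant ::
  "real set \<Rightarrow> (real \<Rightarrow> ('a, 'd::finite) config \<Rightarrow> ('a, 'd) config measure) \<Rightarrow> ('a, 'd) config measure \<Rightarrow> bool"
where
  "time_invariant T P \<mu> \<longleftrightarrow> (\<forall>t\<in>T. \<mu> \<bind> P t = \<mu>)"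

definition translation_invariant ::
  "('a::{finite, discrete_topology}, 'd::finite) config measure \<Rightarrow> bool"
where
  "translation_invariant \<mu> \<longleftrightarrow> (\<forall>l. distr \<mu> borel (spatial_shift l) = \<mu>)"

(* Q (x, y) is the law started from (x, y). It lives on an arbitrary measurable space M carrying
   the pair process (X, Y), rather than on the product sigma-algebra of all paths: in continuous
   time, limits of paths as t tends to infinity are not events of the latter. *)
definition coupling ::
  "real set \<Rightarrow> (real \<Rightarrow> ('a::{finite, discrete_topology}, 'd::finite) config \<Rightarrow> ('a, 'd) config measure) \<Rightarrow>
   'w measure \<Rightarrow> (('a, 'd) config \<times> ('a, 'd) config \<Rightarrow> 'w measure) \<Rightarrow>
   (real \<Rightarrow> 'w \<Rightarrow> ('a, 'd) config) \<Rightarrow> (real \<Rightarrow> 'w \<Rightarrow> ('a, 'd) config) \<Rightarrow> bool"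
where
  "coupling T P M Q X Y \<longleftrightarrow>
     (\<forall>t\<in>T. X t \<in> M \<rightarrow>\<^sub>M borel \<and> Y t \<in> M \<rightarrow>\<^sub>M borel) \<and>
     Q \<in> borel \<Otimes>\<^sub>M borel \<rightarrow>\<^sub>M prob_algebra M \<and>
     (\<forall>x y. AE \<omega> in Q (x, y). X 0 \<omega> = x \<and> Y 0 \<omega> = y) \<and>
     (\<forall>x y. \<forall>t\<in>T. distr (Q (x, y)) borel (X t) = P t x \<and> distr (Q (x, y)) borel (Y t) = P t y)"

end

theory Submission
  imports Defs
begin

text \<open>
  Fix a cylinder event \<open>C\<close> and let \<open>S\<^sub>n x\<close> be the frequency of \<open>C\<close> among the
  translates of \<open>x\<close> by the sites of the cube of radius \<open>n\<close>. Two facts about \<open>S\<^sub>n\<close>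
  carry the proof. Under a translation invariant law \<open>\<mu>\<close> the mean of \<open>S\<^sub>n\<close> is exactly
  \<open>\<mu> C\<close>, for every \<open>n\<close>. And a discrepancy of small upper density, even
  after a fixed spatial translation, changes \<open>S\<^sub>n\<close> only little when \<open>n\<close> is large: one
  discrepancy affects at most as many translates as \<open>C\<close> has sites, and a translation only
  exchanges sites near the boundary of the cube.

  Let \<open>\<mu>\<close> and \<open>\<nu>\<close> be two candidates. Start the coupling from \<open>\<mu> \<Otimes> \<nu>\<close>. By invariance
  in time the two components have laws \<open>\<mu>\<close> and \<open>\<nu>\<close> at every time \<open>t\<close>, so that
  \<open>\<bar>\<mu> C - \<nu> C\<bar> \<le> E \<bar>S\<^sub>n \<xi>\<^sub>t - S\<^sub>n \<xi>'\<^sub>t\<bar>\<close> for all \<open>n\<close> and \<open>t\<close>. The left side does not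
  depend on \<open>n\<close>, hence the reverse Fatou lemma puts the limit superior over \<open>n\<close> inside the
  expectation (\<open>measure_diff_le_expected_gap\<close>). This inner limit superior is at most \<open>1\<close> and,
  by the assumption on the coupling, tends to \<open>0\<close> almost surely as \<open>t\<close> grows
  (\<open>frequency_gap_tendsto_0\<close>), so its expectation tends to \<open>0\<close> by dominated convergence.
  Therefore \<open>\<mu> C = \<nu> C\<close> for all cylinders, and cylinders determine a probability measure
  (\<open>prob_eqI_cylinders\<close>).
\<close>

section \<open>Cubes in the integer lattice\<close>

definition cube :: "nat \<Rightarrow> (int ^ 'd::finite) set" where
  "cube n = {k. lattice_norm k \<le> int n}"

lemma mem_cube_iff: "k \<in> cube n \<longleftrightarrow> (\<forall>i. \<bar>k $ i\<bar> \<le> int n)"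
  by (auto simp: cube_def lattice_norm_def)

text \<open>The cube as a product of intervals, which reduces its finiteness and cardinality to those
  of a product over the coordinates.\<close>

lemma cube_eq_image: "(cube n :: (int ^ 'd::finite) set) = vec_lambda ` (PiE UNIV (\<lambda>_. {- int n..int n}))"
proof (intro set_eqI iffI)
  fix k :: "int ^ 'd" assume "k \<in> cube n"
  then have "(\<lambda>i. k $ i) \<in> PiE UNIV (\<lambda>_. {- int n..int n})"
    by (auto simp: mem_cube_iff abs_le_iff) (metis minus_le_iff)
  then have "vec_lambda (\<lambda>i. k $ i) \<in> vec_lambda ` (PiE UNIV (\<lambda>_. {- int n..int n}))"
    by (rule imageI)
  then show "k \<in> vec_lambda ` (PiE UNIV (\<lambda>_. {- int n..int n}))"
    by simp
qed (auto simp: mem_cube_iff PiE_iff abs_le_iff minus_le_iff)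

lemma finite_cube [simp]: "finite (cube n)"
  unfolding cube_eq_image by (intro finite_imageI finite_PiE) auto

lemma card_cube: "card (cube n :: (int ^ 'd::finite) set) = (2 * n + 1) ^ CARD('d)"
proof -
  have "inj_on (vec_lambda :: ('d \<Rightarrow> int) \<Rightarrow> int ^ 'd) A" for A
    by (auto simp: inj_on_def vec_lambda_inject)
  then have "card (cube n :: (int ^ 'd) set) = card (PiE (UNIV :: 'd set) (\<lambda>_. {- int n..int n}))"
    unfolding cube_eq_image by (rule card_image)
  also have "\<dots> = (2 * n + 1) ^ CARD('d)"
    by (simp add: card_PiE nat_add_distrib nat_mult_distrib)
  finally show ?thesis .
qed

lemma card_cube_pos: "0 < card (cube n :: (int ^ 'd::finite) set)"
  by (simp add: card_cube)

lemma cube_nonempty [simp]: "cube n \<noteq> {}"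
  by (metis card.empty card_cube_pos less_irrefl)

lemma cube_translate: "k \<in> cube n \<Longrightarrow> l \<in> cube m \<Longrightarrow> k + l \<in> cube (n + m)"
  unfolding mem_cube_iff by (auto intro: order_trans[OF abs_triangle_ineq] add_mono)

lemma cube_mono: "n \<le> m \<Longrightarrow> cube n \<subseteq> cube m"
  by (auto simp: cube_def)

lemma finite_subset_cube: "finite A \<Longrightarrow> \<exists>m. A \<subseteq> cube m"
proof (induction A rule: finite_induct)
  case (insert k A)
  then obtain m where "A \<subseteq> cube m" by auto
  moreover have "k \<in> cube (nat (lattice_norm k))"
    by (auto simp: cube_def)
  ultimately have "insert k A \<subseteq> cube (max m (nat (lattice_norm k)))"
    using cube_mono[of m "max m (nat (lattice_norm k))"]
      cube_mono[of "nat (lattice_norm k)" "max m (nat (lattice_norm k))"]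
    by auto
  then show ?case by blast
qed simp

text \<open>The boundary layer of fixed width \<open>m\<close> is negligible compared with the cube: the ratio is the
  power \<open>CARD('d)\<close> of \<open>1 + 2 m / (2 n + 1)\<close>.\<close>

lemma card_cube_ratio_tendsto:
  "(\<lambda>n. real (card (cube (n + m) :: (int ^ 'd::finite) set)) / real (card (cube n :: (int ^ 'd) set)))
     \<longlonglongrightarrow> 1"
proof -
  have "(\<lambda>n. 1 + real (2 * m) / real (2 * n + 1)) \<longlonglongrightarrow> 1 + 0"
    by (intro tendsto_intros tendsto_divide_0[OF tendsto_const] filterlim_at_top_imp_at_infinity
        filterlim_compose[OF filterlim_real_sequentially] filterlim_subseq) (simp add: strict_mono_def)
  moreover have "1 + real (2 * m) / real (2 * n + 1) = real (2 * (n + m) + 1) / real (2 * n + 1)" for n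
    by (simp add: field_simps)
  ultimately have "(\<lambda>n. real (2 * (n + m) + 1) / real (2 * n + 1)) \<longlonglongrightarrow> 1"
    by simp
  from tendsto_power[OF this, of "CARD('d)"] show ?thesis
    by (simp add: card_cube power_divide)
qed

section \<open>Frequencies of translates\<close>

definition frequency :: "('a, 'd::finite) config set \<Rightarrow> nat \<Rightarrow> ('a, 'd) config \<Rightarrow> real" where
  "frequency C n x =
     (\<Sum>k\<in>cube n. indicator C (spatial_shift k x)) / real (card (cube n :: (int ^ 'd) set))"

lemma frequency_bounds:
  fixes x :: "('a, 'd::finite) config"
  shows "0 \<le> frequency C n x" "frequency C n x \<le> 1"
proof -
  show "0 \<le> frequency C n x"
    by (auto simp: frequency_def intro!: divide_nonneg_nonneg sum_nonneg)
  have "(\<Sum>k\<in>cube n. indicator C (spatial_shift k x)) \<le> (\<Sum>k\<in>(cube n :: (int ^ 'd) set). 1 :: real)"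
    by (intro sum_mono) (auto simp: indicator_def)
  then show "frequency C n x \<le> 1"
    unfolding frequency_def using card_cube_pos by (subst divide_le_eq_1_pos) auto
qed

lemma abs_frequency_diff_le_1: "\<bar>frequency C n x - frequency C n y\<bar> \<le> 1"
  using frequency_bounds[of C n x] frequency_bounds[of C n y] by linarith

text \<open>Only the elements of \<open>A\<close> outside \<open>B\<close>, or of \<open>B\<close> outside \<open>A\<close>, matter, and each of
  these two sets lies in the complement in \<open>E\<close> of a set of the common cardinality.\<close>

lemma sum_diff_le_card:
  fixes g :: "'k \<Rightarrow> real"
  assumes "finite E" "A \<subseteq> E" "B \<subseteq> E" "card A = card B" "\<And>k. 0 \<le> g k" "\<And>k. g k \<le> 1"
  shows "\<bar>sum g A - sum g B\<bar> \<le> real (card E) - real (card A)"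
proof -
  have *: "sum g A' \<le> sum g B' + (real (card E) - real (card B'))" if "A' \<subseteq> E" "B' \<subseteq> E" for A' B'
  proof -
    have fin: "finite B'" using that assms(1) finite_subset by blast
    have "sum g A' \<le> sum g E"
      using that assms by (intro sum_mono2) auto
    also have "\<dots> = sum g B' + sum g (E - B')"
      using that assms(1) by (subst sum.subset_diff[of B' E]) auto
    also have "sum g (E - B') \<le> (\<Sum>k\<in>E - B'. 1)"
      using assms by (intro sum_mono) auto
    also have "\<dots> = real (card E) - real (card B')"
      using that assms(1) fin by (simp add: card_Diff_subset card_mono of_nat_diff)
    finally show ?thesis by simp
  qed
  from *[of A B] *[of B A] assms show ?thesis by auto
qed

text \<open>Translating the configuration amounts to translating the cube over which the average is
  taken. Both cubes lie in the cube of radius \<open>n + m\<close>, so the averages differ by at most the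
  relative size of the boundary layer.\<close>

lemma frequency_spatial_shift:
  fixes y :: "('a, 'd::finite) config"
  assumes "l \<in> cube m"
  shows "\<bar>frequency C n (spatial_shift l y) - frequency C n y\<bar>
           \<le> real (card (cube (n + m) :: (int ^ 'd) set)) / real (card (cube n :: (int ^ 'd) set)) - 1"
proof -
  define g :: "int ^ 'd \<Rightarrow> real" where "g k = indicator C (spatial_shift k y)" for k
  have shift: "indicator C (spatial_shift k (spatial_shift l y)) = g (k + l)" for k
    by (simp add: g_def spatial_shift_def add.assoc)
  have inj: "inj_on (\<lambda>k. k + l) (cube n)"
    by (simp add: inj_on_def)
  have "\<bar>sum g ((\<lambda>k. k + l) ` cube n) - sum g (cube n)\<bar>
          \<le> real (card (cube (n + m) :: (int ^ 'd) set)) - real (card ((\<lambda>k. k + l) ` cube n))"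
    using assms cube_mono[of n "n + m"] card_image[OF inj]
    by (intro sum_diff_le_card) (auto simp: g_def cube_translate)
  then have "\<bar>(\<Sum>k\<in>cube n. g (k + l)) - sum g (cube n)\<bar>
          \<le> real (card (cube (n + m) :: (int ^ 'd) set)) - real (card (cube n :: (int ^ 'd) set))"
    using inj by (simp add: sum.reindex card_image)
  then have "\<bar>(\<Sum>k\<in>cube n. g (k + l)) - sum g (cube n)\<bar> / real (card (cube n :: (int ^ 'd) set))
          \<le> (real (card (cube (n + m) :: (int ^ 'd) set)) - real (card (cube n :: (int ^ 'd) set)))
              / real (card (cube n :: (int ^ 'd) set))"
    by (intro divide_right_mono) auto
  then show ?thesis
    using card_cube_pos[of n, where 'd='d]
    unfolding frequency_def shift g_def[symmetric] diff_divide_distrib[symmetric] abs_divide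
    by (simp add: diff_divide_distrib)
qed

text \<open>Prescriptions are finite lists of sites and letters, and they may contradict each other.
  In this way intersection of cylinders is concatenation, and for a countable set of sites and a
  finite alphabet the cylinders are indexed by a countable type.\<close>

definition cylinder :: "('k \<times> 'a) list \<Rightarrow> ('k \<Rightarrow> 'a) set" where
  "cylinder p = {x. \<forall>(i, a)\<in>set p. x i = a}"

text \<open>Membership of the translates by \<open>k\<close> in the cylinder can differ only if \<open>x\<close> and \<open>y\<close>
  disagree at \<open>i + k\<close> for some prescribed site \<open>i\<close>. For fixed \<open>i\<close>, distinct \<open>k\<close> give
  distinct discrepancies, all within radius \<open>n + m\<close>, so every discrepancy is charged at
  most once for each prescribed site.\<close>

lemma frequency_cylinder_diff:
  fixes x y :: "('a, 'd::finite) config"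
  assumes sites: "fst ` set p \<subseteq> cube m"
  shows "\<bar>frequency (cylinder p) n x - frequency (cylinder p) n y\<bar>
           \<le> real (card (fst ` set p)) * real (card {k. x k \<noteq> y k \<and> lattice_norm k \<le> int (n + m)})
               / real (card (cube n :: (int ^ 'd) set))"
proof -
  define D where "D = {k. x k \<noteq> y k \<and> lattice_norm k \<le> int (n + m)}"
  have finD: "finite D"
    by (rule finite_subset[OF _ finite_cube[of "n + m"]]) (auto simp: D_def cube_def)
  have pointwise: "\<bar>indicator (cylinder p) (spatial_shift k x) - indicator (cylinder p) (spatial_shift k y)\<bar>
          \<le> (\<Sum>i\<in>fst ` set p. indicator D (i + k) :: real)" if "k \<in> cube n" for k
  proof (cases "\<exists>i\<in>fst ` set p. x (i + k) \<noteq> y (i + k)")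
    case True
    then obtain i where i: "i \<in> fst ` set p" "x (i + k) \<noteq> y (i + k)" by blast
    have "i + k \<in> cube (n + m)"
      using cube_translate[OF that, of i m] sites i by (auto simp: add.commute)
    then have "(1 :: real) = indicator D (i + k)"
      using i by (auto simp: D_def cube_def indicator_def)
    also have "\<dots> \<le> (\<Sum>i\<in>fst ` set p. indicator D (i + k))"
      using i by (intro member_le_sum) auto
    finally show ?thesis
      by (auto simp: indicator_def split: if_splits)
  next
    case False
    then have "spatial_shift k x \<in> cylinder p \<longleftrightarrow> spatial_shift k y \<in> cylinder p"
      unfolding cylinder_def spatial_shift_def by force
    then show ?thesis
      by (auto simp: indicator_def intro!: sum_nonneg)
  qed
  have count: "(\<Sum>k\<in>cube n. indicator D (i + k) :: real) \<le> real (card D)" for i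
  proof -
    have "(\<Sum>k\<in>cube n. indicator D (i + k) :: real) = (\<Sum>k\<in>(\<lambda>k. i + k) ` cube n. indicator D k)"
      by (subst sum.reindex) (auto simp: inj_on_def)
    also have "\<dots> = real (card ((\<lambda>k. i + k) ` cube n \<inter> D))"
      unfolding real_of_card sum.inter_restrict[OF finite_imageI[OF finite_cube]]
      by (intro sum.cong) (auto simp: indicator_def)
    also have "\<dots> \<le> real (card D)"
      using finD by (simp add: card_mono)
    finally show ?thesis .
  qed
  have "\<bar>(\<Sum>k\<in>cube n. indicator (cylinder p) (spatial_shift k x))
          - (\<Sum>k\<in>cube n. indicator (cylinder p) (spatial_shift k y))\<bar>
        \<le> (\<Sum>k\<in>cube n. \<bar>indicator (cylinder p) (spatial_shift k x)
                          - indicator (cylinder p) (spatial_shift k y)\<bar> :: real)"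
    unfolding sum_subtractf[symmetric] by (rule sum_abs)
  also have "\<dots> \<le> (\<Sum>k\<in>cube n. \<Sum>i\<in>fst ` set p. indicator D (i + k))"
    by (intro sum_mono pointwise)
  also have "\<dots> = (\<Sum>i\<in>fst ` set p. \<Sum>k\<in>cube n. indicator D (i + k))"
    by (rule sum.swap)
  also have "\<dots> \<le> real (card (fst ` set p)) * real (card D)"
    by (rule sum_bounded_above) (rule count)
  finally have "\<bar>(\<Sum>k\<in>cube n. indicator (cylinder p) (spatial_shift k x))
          - (\<Sum>k\<in>cube n. indicator (cylinder p) (spatial_shift k y))\<bar>
        \<le> real (card (fst ` set p)) * real (card D)" .
  from divide_right_mono[OF this, of "real (card (cube n :: (int ^ 'd) set))"]
  show ?thesis
    unfolding frequency_def D_def diff_divide_distrib[symmetric] abs_divide by simp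
qed

section \<open>Asymptotic frequency gaps and the upper density of discrepancies\<close>

text \<open>The values are extended nonnegative reals because the gap is later integrated by the
  reverse Fatou lemma for nonnegative functions.\<close>

definition frequency_gap :: "('a, 'd::finite) config set \<Rightarrow> ('a, 'd) config \<Rightarrow> ('a, 'd) config \<Rightarrow> ennreal"
where
  "frequency_gap C x y = limsup (\<lambda>n. ennreal \<bar>frequency C n x - frequency C n y\<bar>)"

lemma frequency_gap_le_1: "frequency_gap C x y \<le> 1"
  unfolding frequency_gap_def
  by (intro Limsup_bounded always_eventually allI) (simp add: abs_frequency_diff_le_1)

text \<open>Insert the translate of \<open>y\<close> between \<open>x\<close> and \<open>y\<close>: it is close to \<open>x\<close> in density and
  has asymptotically the same frequencies as \<open>y\<close>. The limit superior absorbs the translation,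
  so the bound does not depend on \<open>l\<close>.\<close>

lemma frequency_gap_le:
  fixes x y :: "('a, 'd::finite) config"
  assumes less: "upper_discrepancy x (spatial_shift l y) < ereal e"
  shows "frequency_gap (cylinder p) x y \<le> ennreal ((2 * real (card (fst ` set p)) + 1) * e)"
proof -
  let ?B = "\<lambda>n. real (card (cube n :: (int ^ 'd) set))"
  let ?D = "\<lambda>n. real (card {k. x k \<noteq> spatial_shift l y k \<and> lattice_norm k \<le> int n})"
  define c where "c = real (card (fst ` set p))"
  obtain m where m: "insert l (fst ` set p) \<subseteq> cube m"
    using finite_subset_cube[of "insert l (fst ` set p)"] by auto
  have Bpos: "0 < ?B n" for n
    using card_cube_pos by simp
  have ev: "\<forall>\<^sub>F n in sequentially. ?D n / ?B n < e"
    using Limsup_lessD[OF less[unfolded upper_discrepancy_def]] by (simp add: card_cube)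
  then have e: "0 < e"
    by (auto simp: eventually_sequentially) (meson divide_nonneg_nonneg le_less_trans of_nat_0_le_iff order_refl)
  have "\<forall>\<^sub>F n in sequentially. ?D (n + m) / ?B (n + m) < e"
    by (rule eventually_sequentially_seg[of "\<lambda>n. ?D n / ?B n < e" m, THEN iffD2, OF ev])
  \<comment> \<open>The bound \<open>2\<close> converts a density in the larger cube into one in the smaller cube; the bound
      \<open>1 + e\<close> controls the cost of the translation.\<close>
  moreover have "\<forall>\<^sub>F n in sequentially. ?B (n + m) / ?B n < 1 + min 1 e"
    using order_tendstoD(2)[OF card_cube_ratio_tendsto, of "1 + min 1 e"] e by auto
  ultimately have "\<forall>\<^sub>F n in sequentially.
      \<bar>frequency (cylinder p) n x - frequency (cylinder p) n y\<bar> \<le> (2 * c + 1) * e"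
  proof eventually_elim
    case (elim n)
    have "\<bar>frequency (cylinder p) n x - frequency (cylinder p) n (spatial_shift l y)\<bar>
            \<le> c * ?D (n + m) / ?B n"
      unfolding c_def using m by (intro frequency_cylinder_diff) auto
    also have "\<dots> = c * ((?D (n + m) / ?B (n + m)) * (?B (n + m) / ?B n))"
      using Bpos[of "n + m"] by simp
    also have "\<dots> \<le> c * (e * 2)"
      using elim e by (intro mult_left_mono mult_mono) (auto simp: c_def)
    finally have "\<bar>frequency (cylinder p) n x - frequency (cylinder p) n (spatial_shift l y)\<bar>
            \<le> 2 * c * e"
      by simp
    moreover have "\<bar>frequency (cylinder p) n (spatial_shift l y) - frequency (cylinder p) n y\<bar>
            \<le> ?B (n + m) / ?B n - 1"
      using m by (intro frequency_spatial_shift) auto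
    ultimately show ?case
      using elim by (simp add: distrib_right)
  qed
  then show ?thesis
    unfolding frequency_gap_def c_def[symmetric]
    by (intro Limsup_bounded) (auto elim!: eventually_mono intro: ennreal_leI)
qed

lemma frequency_gap_tendsto_0:
  fixes x y :: "'t \<Rightarrow> ('a, 'd::finite) config"
  assumes lim: "((\<lambda>t. upper_discrepancy (x t) (spatial_shift l (y t))) \<longlongrightarrow> 0) F"
  shows "((\<lambda>t. frequency_gap (cylinder p) (x t) (y t)) \<longlongrightarrow> 0) F"
proof (rule order_tendstoI)
  fix u :: ennreal assume "0 < u"
  define c where "c = 2 * real (card (fst ` set p)) + 1"
  have c: "0 < c" by (simp add: c_def)
  obtain z where z: "0 < z" "z < u"
    using dense[OF \<open>0 < u\<close>] by blast
  then obtain r where r: "0 < r" "ennreal r < u"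
    by (cases z) auto
  have "\<forall>\<^sub>F t in F. upper_discrepancy (x t) (spatial_shift l (y t)) < ereal (r / c)"
    using order_tendstoD(2)[OF lim, of "ereal (r / c)"] r c by simp
  then show "\<forall>\<^sub>F t in F. frequency_gap (cylinder p) (x t) (y t) < u"
  proof eventually_elim
    case (elim t)
    from frequency_gap_le[OF elim, of p] have "frequency_gap (cylinder p) (x t) (y t) \<le> ennreal r"
      using c by (simp flip: c_def)
    with r show ?case by simp
  qed
qed simp

section \<open>Cylinders determine probability measures\<close>

lemma open_cylinder:
  fixes p :: "('k \<times> 'a::discrete_topology) list"
  shows "open (cylinder p)"
proof -
  have "cylinder p = (\<Inter>(i, a)\<in>set p. {x. x i \<in> {a}})"
    by (auto simp: cylinder_def)
  moreover have "open {x :: 'k \<Rightarrow> 'a. x i \<in> {a}}" for i a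
    using open_vimage[OF discrete_topology_class.open_discrete[of "{a}"] continuous_on_product_coordinates[of i]]
    by (simp add: vimage_def)
  ultimately show ?thesis
    by (auto intro!: open_INT)
qed

lemma cylinder_in_borel [measurable]:
  fixes p :: "('k \<times> 'a::discrete_topology) list"
  shows "cylinder p \<in> sets borel"
  by (simp add: open_cylinder)

lemma cylinder_Nil: "cylinder [] = UNIV"
  by (simp add: cylinder_def)

lemma cylinder_append: "cylinder (p @ q) = cylinder p \<inter> cylinder q"
  by (simp add: cylinder_def ball_Un Collect_conj_eq)

text \<open>The discreteness of the alphabet allows a basic open neighbourhood, which constrains
  finitely many sites, to be shrunk to one fixing the values of \<open>x\<close> at these sites.\<close>

lemma open_contains_cylinder:
  fixes U :: "('k \<Rightarrow> 'a::discrete_topology) set"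
  assumes "open U" "x \<in> U"
  shows "\<exists>p. x \<in> cylinder p \<and> cylinder p \<subseteq> U"
proof -
  have "openin (product_topology (\<lambda>i. euclidean) UNIV) U"
    using assms(1) by (simp add: open_fun_def)
  from product_topology_open_contains_basis[OF this assms(2)]
  obtain V where V: "x \<in> PiE UNIV V" "finite {i. V i \<noteq> UNIV}" "PiE UNIV V \<subseteq> U"
    by auto
  obtain js where js: "set js = {i. V i \<noteq> UNIV}"
    using finite_list[OF V(2)] by blast
  have "cylinder (map (\<lambda>i. (i, x i)) js) \<subseteq> PiE UNIV V"
  proof
    fix y assume y: "y \<in> cylinder (map (\<lambda>i. (i, x i)) js)"
    have "y i \<in> V i" for i
    proof (cases "V i = UNIV")
      case False
      with y js have "y i = x i" by (auto simp: cylinder_def)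
      with V(1) show ?thesis by (auto simp: PiE_iff)
    qed simp
    then show "y \<in> PiE UNIV V" by (simp add: PiE_iff)
  qed
  with V(3) show ?thesis
    by (intro exI[of _ "map (\<lambda>i. (i, x i)) js"]) (auto simp: cylinder_def)
qed

text \<open>There are only countably many cylinders, so every open set is a countable union of
  them.\<close>

lemma borel_eq_sigma_cylinders:
  "sets (borel :: ('k::countable \<Rightarrow> 'a::{finite, discrete_topology}) measure)
     = sigma_sets UNIV (range cylinder)"
proof -
  have "U \<in> sigma_sets UNIV (range cylinder)" if "open U" for U :: "('k \<Rightarrow> 'a) set"
  proof -
    have "U = (\<Union>p\<in>{p. cylinder p \<subseteq> U}. cylinder p)"
      using open_contains_cylinder[OF that] by blast
    also have "\<dots> \<in> sigma_sets UNIV (range cylinder)"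
      by (intro sigma_sets_UNION) (auto intro: sigma_sets.Basic)
    finally show ?thesis .
  qed
  then have "(borel :: ('k \<Rightarrow> 'a) measure) = sigma UNIV (range cylinder)"
    unfolding borel_def
    by (intro sigma_eqI sigma_sets_eqI) (auto intro!: sigma_sets.Basic open_cylinder)
  then show ?thesis
    by (metis sets_measure_of subset_UNIV Pow_UNIV)
qed

lemma prob_eqI_cylinders:
  fixes \<mu> \<nu> :: "('k::countable \<Rightarrow> 'a::{finite, discrete_topology}) measure"
  assumes "prob_space \<mu>" "prob_space \<nu>"
    and sets: "sets \<mu> = sets borel" "sets \<nu> = sets borel"
    and eq: "\<And>p. measure \<mu> (cylinder p) = measure \<nu> (cylinder p)"
  shows "\<mu> = \<nu>"
proof -
  interpret mu: prob_space \<mu> by fact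
  interpret nu: prob_space \<nu> by fact
  show ?thesis
  proof (rule measure_eqI_generator_eq[where \<Omega> = UNIV and E = "range cylinder" and A = "\<lambda>_. cylinder []"])
    show "Int_stable (range cylinder :: ('k \<Rightarrow> 'a) set set)"
      by (auto simp: Int_stable_def simp flip: cylinder_append)
  qed (auto simp: sets borel_eq_sigma_cylinders mu.emeasure_eq_measure nu.emeasure_eq_measure eq
      cylinder_Nil intro: range_eqI[of _ _ "[]"])
qed

section \<open>Expected frequencies under translation invariant laws\<close>

lemma measurable_spatial_shift [measurable]:
  "spatial_shift l \<in> borel \<rightarrow>\<^sub>M (borel :: ('a::{finite, discrete_topology}, 'd::finite) config measure)"
  unfolding spatial_shift_def
  by (intro borel_measurable_continuous_onI continuous_on_coordinatewise_then_product
      continuous_on_product_coordinates)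

lemma measurable_frequency [measurable]:
  fixes C :: "('a::{finite, discrete_topology}, 'd::finite) config set"
  assumes [measurable]: "C \<in> sets borel"
  shows "frequency C n \<in> borel_measurable borel"
  unfolding frequency_def by measurable

lemma expectation_frequency:
  fixes \<mu> :: "('a::{finite, discrete_topology}, 'd::finite) config measure"
  assumes "prob_space \<mu>" "sets \<mu> = sets borel" "translation_invariant \<mu>" "C \<in> sets borel"
  shows "(\<integral>x. frequency C n x \<partial>\<mu>) = measure \<mu> C"
proof -
  interpret prob_space \<mu> by fact
  have [measurable_cong]: "sets \<mu> = sets borel" and [measurable]: "C \<in> sets borel" by fact+
  have "(\<integral>x. indicator C (spatial_shift k x) \<partial>\<mu>) = measure \<mu> C" for k
  proof -
    have "(\<integral>x. indicator C (spatial_shift k x) \<partial>\<mu>)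
            = (\<integral>x. (indicator C x :: real) \<partial>distr \<mu> borel (spatial_shift k))"
      by (subst integral_distr) auto
    also have "\<dots> = (\<integral>x. indicator C x \<partial>\<mu>)"
      using assms(3) by (simp add: translation_invariant_def)
    also have "\<dots> = measure \<mu> C"
      using assms(2,4) by (simp add: sets_eq_imp_space_eq)
    finally show ?thesis .
  qed
  moreover have "integrable \<mu> (\<lambda>x. indicator C (spatial_shift k x) :: real)" for k
    by (rule integrable_const_bound[of _ 1]) auto
  ultimately show ?thesis
    using card_cube_pos[of n, where 'd='d] by (simp add: frequency_def)
qed

lemma measurable_frequency_gap [measurable (raw)]:
  fixes C :: "('a::{finite, discrete_topology}, 'd::finite) config set"
  assumes [measurable]: "C \<in> sets borel" "f \<in> M \<rightarrow>\<^sub>M borel" "g \<in> M \<rightarrow>\<^sub>M borel"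
  shows "(\<lambda>\<omega>. frequency_gap C (f \<omega>) (g \<omega>)) \<in> borel_measurable M"
  unfolding frequency_gap_def by measurable

text \<open>The bound holds for the averages over each finite cube, where the expectations are exact by
  translation invariance. The reverse Fatou lemma, with the constant \<open>1\<close> as majorant, then passes
  to the limit superior.\<close>

lemma measure_diff_le_expected_gap:
  fixes \<mu> \<nu> :: "('a::{finite, discrete_topology}, 'd::finite) config measure"
  assumes R: "prob_space R" and [measurable]: "f \<in> R \<rightarrow>\<^sub>M borel" "g \<in> R \<rightarrow>\<^sub>M borel" "C \<in> sets borel"
    and mu: "distr R borel f = \<mu>" "translation_invariant \<mu>"
    and nu: "distr R borel g = \<nu>" "translation_invariant \<nu>"
  shows "ennreal \<bar>measure \<mu> C - measure \<nu> C\<bar> \<le> (\<integral>\<^sup>+\<omega>. frequency_gap C (f \<omega>) (g \<omega>) \<partial>R)"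
proof -
  interpret R: prob_space R by fact
  have "ennreal \<bar>measure \<mu> C - measure \<nu> C\<bar> \<le> (\<integral>\<^sup>+\<omega>. ennreal \<bar>frequency C n (f \<omega>) - frequency C n (g \<omega>)\<bar> \<partial>R)"
    for n
  proof -
    have int: "integrable R (\<lambda>\<omega>. frequency C n (h \<omega>))" if [measurable]: "h \<in> R \<rightarrow>\<^sub>M borel" for h
      by (rule R.integrable_const_bound[of _ 1]) (auto simp: frequency_bounds)
    have expect: "(\<integral>\<omega>. frequency C n (h \<omega>) \<partial>R) = measure \<kappa> C"
      if [measurable]: "h \<in> R \<rightarrow>\<^sub>M borel" and "distr R borel h = \<kappa>" "translation_invariant \<kappa>" for h \<kappa>
    proof -
      have "(\<integral>\<omega>. frequency C n (h \<omega>) \<partial>R) = (\<integral>x. frequency C n x \<partial>distr R borel h)"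
        by (subst integral_distr) auto
      also have "\<dots> = measure \<kappa> C"
        using that R.prob_space_distr[of h borel] by (auto intro!: expectation_frequency)
      finally show ?thesis .
    qed
    have "\<bar>measure \<mu> C - measure \<nu> C\<bar> = \<bar>\<integral>\<omega>. frequency C n (f \<omega>) - frequency C n (g \<omega>) \<partial>R\<bar>"
      using mu nu by (simp add: int expect[of f \<mu>] expect[of g \<nu>])
    also have "\<dots> \<le> (\<integral>\<omega>. \<bar>frequency C n (f \<omega>) - frequency C n (g \<omega>)\<bar> \<partial>R)"
      by (rule integral_abs_bound)
    finally have "ennreal \<bar>measure \<mu> C - measure \<nu> C\<bar>
                    \<le> ennreal (\<integral>\<omega>. \<bar>frequency C n (f \<omega>) - frequency C n (g \<omega>)\<bar> \<partial>R)"
      by (rule ennreal_leI)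
    also have "\<dots> = (\<integral>\<^sup>+\<omega>. ennreal \<bar>frequency C n (f \<omega>) - frequency C n (g \<omega>)\<bar> \<partial>R)"
      by (intro nn_integral_eq_integral[symmetric]) (auto simp: int)
    finally show ?thesis .
  qed
  then have "ennreal \<bar>measure \<mu> C - measure \<nu> C\<bar>
      \<le> limsup (\<lambda>n. \<integral>\<^sup>+\<omega>. ennreal \<bar>frequency C n (f \<omega>) - frequency C n (g \<omega>)\<bar> \<partial>R)"
    by (intro le_Limsup always_eventually) auto
  also have "\<dots> \<le> (\<integral>\<^sup>+\<omega>. frequency_gap C (f \<omega>) (g \<omega>) \<partial>R)"
    unfolding frequency_gap_def
    by (intro nn_integral_limsup[where w = "\<lambda>_. 1"])
       (auto simp: abs_frequency_diff_le_1 R.emeasure_space_1)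
  finally show ?thesis .
qed

section \<open>Randomized initial configurations\<close>

lemma distr_pair_snd:
  assumes "prob_space \<mu>" "prob_space \<nu>"
  shows "distr (\<mu> \<Otimes>\<^sub>M \<nu>) \<nu> snd = \<nu>"
proof (rule measure_eqI)
  interpret mu: prob_space \<mu> by fact
  interpret nu: prob_space \<nu> by fact
  fix A assume "A \<in> sets (distr (\<mu> \<Otimes>\<^sub>M \<nu>) \<nu> snd)"
  then have A: "A \<in> sets \<nu>" by simp
  have "snd -` A \<inter> space (\<mu> \<Otimes>\<^sub>M \<nu>) = space \<mu> \<times> A"
    using sets.sets_into_space[OF A] by (auto simp: space_pair_measure)
  then show "emeasure (distr (\<mu> \<Otimes>\<^sub>M \<nu>) \<nu> snd) A = emeasure \<nu> A"
    using A by (simp add: emeasure_distr nu.emeasure_pair_measure_Times mu.emeasure_space_1)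
qed simp

text \<open>The properties \<open>A\<close> and \<open>B\<close> may fail to be measurable, which is why the proof transports
  almost sure statements along the projections.\<close>

lemma AE_pair_measure_components:
  assumes "prob_space \<mu>" "prob_space \<nu>" "AE x in \<mu>. A x" "AE y in \<nu>. B y"
  shows "AE z in \<mu> \<Otimes>\<^sub>M \<nu>. A (fst z) \<and> B (snd z)"
proof -
  have "AE z in \<mu> \<Otimes>\<^sub>M \<nu>. A (fst z)"
    by (rule AE_distrD[OF measurable_fst]) (simp only: prob_space.distr_pair_fst[OF assms(2)] assms(3))
  moreover have "AE z in \<mu> \<Otimes>\<^sub>M \<nu>. B (snd z)"
    by (rule AE_distrD[OF measurable_snd]) (simp only: distr_pair_snd[OF assms(1,2)] assms(4))
  ultimately show ?thesis by eventually_elim simp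
qed

text \<open>If under the kernel \<open>Q\<close> the law of \<open>f\<close> depends on the starting point only through \<open>h\<close>,
  then randomizing the starting point randomizes only \<open>h\<close>. With \<open>h\<close> a projection,
  this yields the one-component laws of a coupling started from a product measure.\<close>

lemma distr_bind_marginal:
  assumes h: "h \<in> R \<rightarrow>\<^sub>M N" and R: "prob_space R" "distr R N h = \<mu>"
    and Q: "Q \<in> R \<rightarrow>\<^sub>M prob_algebra M" and f: "f \<in> M \<rightarrow>\<^sub>M K" and P: "P \<in> N \<rightarrow>\<^sub>M prob_algebra K"
    and law: "\<And>z. distr (Q z) K f = P (h z)"
  shows "distr (R \<bind> Q) K f = \<mu> \<bind> P"
proof -
  interpret prob_space R by fact
  have "distr (R \<bind> Q) K f = R \<bind> (\<lambda>z. distr (Q z) K f)"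
    using Q f not_empty by (intro distr_bind measurable_prob_algebraD)
  also have "\<dots> = distr R N h \<bind> P"
    unfolding law using h P not_empty by (intro bind_distr[symmetric] measurable_prob_algebraD)
  finally show ?thesis
    using R by simp
qed

section \<open>Uniqueness of the invariant measure\<close>

theorem theorem5p1:
  fixes T :: "real set"
    and P :: "real \<Rightarrow> ('a::{finite, discrete_topology}, 'd::finite) config \<Rightarrow> ('a, 'd) config measure"
    and X\<^sub>r :: "('a, 'd) config set"
    and L :: real
    and M :: "'w measure"
    and Q :: "('a, 'd) config \<times> ('a, 'd) config \<Rightarrow> 'w measure"
    and \<xi> \<xi>' :: "real \<Rightarrow> 'w \<Rightarrow> ('a, 'd) config"
  assumes "time_set T"
    and "particle_system T P"
    and "dynamically_invariant T P X\<^sub>r"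
    and "shift_invariant_set X\<^sub>r"
    and "coupling T P M Q \<xi> \<xi>'"
    and "\<And>x y. x \<in> X\<^sub>r \<Longrightarrow> y \<in> X\<^sub>r \<Longrightarrow>
           AE \<omega> in Q (x, y). \<exists>l. of_int (lattice_norm l) < L \<and>
             ((\<lambda>t. upper_discrepancy (\<xi> t \<omega>) (spatial_shift l (\<xi>' t \<omega>))) \<longlongrightarrow> 0)
               (inf at_top (principal T))"
  shows "\<exists>\<^sub>\<le>\<^sub>1 \<mu>. prob_space \<mu> \<and> sets \<mu> = sets borel \<and> (AE x in \<mu>. x \<in> X\<^sub>r) \<and>
           translation_invariant \<mu> \<and> time_invariant T P \<mu>"
proof (rule Uniq_I; elim conjE)
  fix \<mu> \<nu> :: "('a, 'd) config measure"
  assume mu: "prob_space \<mu>" "sets \<mu> = sets borel" "AE x in \<mu>. x \<in> X\<^sub>r"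
      "translation_invariant \<mu>" "time_invariant T P \<mu>"
    and nu: "prob_space \<nu>" "sets \<nu> = sets borel" "AE x in \<nu>. x \<in> X\<^sub>r"
      "translation_invariant \<nu>" "time_invariant T P \<nu>"
  interpret mu: prob_space \<mu> by fact
  interpret nu: prob_space \<nu> by fact
  interpret pair: pair_prob_space \<mu> \<nu> ..
  have natT: "real t \<in> T" for t
    using assms(1) by (auto simp: time_set_def)
  have coupling: "\<xi> t \<in> M \<rightarrow>\<^sub>M borel" "\<xi>' t \<in> M \<rightarrow>\<^sub>M borel"
      "distr (Q z) borel (\<xi> t) = P t (fst z)" "distr (Q z) borel (\<xi>' t) = P t (snd z)"
    if "t \<in> T" for t z
    using assms(5) that by (cases z; auto simp: coupling_def)+
  have [measurable]: "\<xi> (real t) \<in> M \<rightarrow>\<^sub>M borel" "\<xi>' (real t) \<in> M \<rightarrow>\<^sub>M borel" for t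
    using coupling natT by auto
  have sets_pair: "sets (\<mu> \<Otimes>\<^sub>M \<nu>) = sets (borel \<Otimes>\<^sub>M borel)"
    using mu(2) nu(2) by (rule sets_pair_measure_cong)
  have Q: "Q \<in> \<mu> \<Otimes>\<^sub>M \<nu> \<rightarrow>\<^sub>M prob_algebra M"
    using assms(5) by (simp add: coupling_def measurable_cong_sets[OF sets_pair refl])
  \<comment> \<open>The law of the coupled process with independent initial configurations.\<close>
  define R where "R = (\<mu> \<Otimes>\<^sub>M \<nu>) \<bind> Q"
  have pair_in: "\<mu> \<Otimes>\<^sub>M \<nu> \<in> space (prob_algebra (\<mu> \<Otimes>\<^sub>M \<nu>))"
    by (simp add: space_prob_algebra pair.prob_space_axioms)
  interpret R: prob_space R
    unfolding R_def by (rule prob_space_bind'[OF pair_in Q])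
  have [measurable_cong]: "sets R = sets M"
    unfolding R_def by (rule sets_bind'[OF pair_in Q])
  have marginals: "distr R borel (\<xi> (real t)) = \<mu>" "distr R borel (\<xi>' (real t)) = \<nu>" for t
  proof -
    have P: "P (real t) \<in> borel \<rightarrow>\<^sub>M prob_algebra borel"
      using assms(2) natT by (simp add: particle_system_def)
    have "distr (\<mu> \<Otimes>\<^sub>M \<nu>) borel fst = \<mu>" "distr (\<mu> \<Otimes>\<^sub>M \<nu>) borel snd = \<nu>"
      using nu.distr_pair_fst[of \<mu>] distr_pair_snd[OF mu(1) nu(1)]
        distr_cong[OF refl mu(2)] distr_cong[OF refl nu(2)] by metis+
    moreover have "fst \<in> \<mu> \<Otimes>\<^sub>M \<nu> \<rightarrow>\<^sub>M borel" "snd \<in> \<mu> \<Otimes>\<^sub>M \<nu> \<rightarrow>\<^sub>M borel"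
      by (simp_all add: measurable_cong_sets[OF sets_pair refl])
    ultimately have "distr R borel (\<xi> (real t)) = \<mu> \<bind> P (real t)"
        "distr R borel (\<xi>' (real t)) = \<nu> \<bind> P (real t)"
      unfolding R_def using P Q natT coupling pair.prob_space_axioms
      by (intro distr_bind_marginal[where N = borel and M = M]; simp)+
    then show "distr R borel (\<xi> (real t)) = \<mu>" "distr R borel (\<xi>' (real t)) = \<nu>"
      using mu(5) nu(5) natT by (simp_all add: time_invariant_def)
  qed
  show "\<mu> = \<nu>"
  proof (rule prob_eqI_cylinders)
    fix p :: "((int ^ 'd) \<times> 'a) list"
    define gap where "gap t \<omega> = frequency_gap (cylinder p) (\<xi> (real t) \<omega>) (\<xi>' (real t) \<omega>)" for t \<omega>
    have [measurable]: "gap t \<in> borel_measurable M" for t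
      unfolding gap_def by measurable
    \<comment> \<open>Integer times belong to either time set. Along this countable sequence the almost sure
        convergence of the gaps is a measurable event, as mixing the laws \<open>Q z\<close> requires.\<close>
    have times: "filterlim real (inf at_top (principal T)) sequentially"
      using natT by (auto simp: filterlim_inf filterlim_principal filterlim_real_sequentially)
    have "AE z in \<mu> \<Otimes>\<^sub>M \<nu>. fst z \<in> X\<^sub>r \<and> snd z \<in> X\<^sub>r"
      by (rule AE_pair_measure_components) fact+
    then have "AE z in \<mu> \<Otimes>\<^sub>M \<nu>. AE \<omega> in Q z. (\<lambda>t. gap t \<omega>) \<longlonglongrightarrow> 0"
    proof eventually_elim
      case (elim z)
      then have "AE \<omega> in Q z. \<exists>l. of_int (lattice_norm l) < L \<and>
             ((\<lambda>t. upper_discrepancy (\<xi> t \<omega>) (spatial_shift l (\<xi>' t \<omega>))) \<longlongrightarrow> 0)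
               (inf at_top (principal T))"
        using assms(6)[of "fst z" "snd z", unfolded prod.collapse] by blast
      then show ?case
      proof eventually_elim
        case (elim \<omega>)
        then obtain l where "((\<lambda>t. upper_discrepancy (\<xi> t \<omega>) (spatial_shift l (\<xi>' t \<omega>))) \<longlongrightarrow> 0)
               (inf at_top (principal T))"
          by blast
        from filterlim_compose[OF this times] show ?case
          unfolding gap_def by (rule frequency_gap_tendsto_0)
      qed
    qed
    then have lim: "AE \<omega> in R. (\<lambda>t. gap t \<omega>) \<longlonglongrightarrow> 0"
      unfolding R_def by (subst AE_bind[OF measurable_prob_algebraD[OF Q]]) auto
    have "(\<lambda>t. \<integral>\<^sup>+\<omega>. gap t \<omega> \<partial>R) \<longlonglongrightarrow> (\<integral>\<^sup>+\<omega>. 0 \<partial>R)"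
      using lim
      by (intro nn_integral_dominated_convergence[where w = "\<lambda>_. 1"])
         (auto simp: gap_def frequency_gap_le_1 R.emeasure_space_1)
    moreover have "ennreal \<bar>measure \<mu> (cylinder p) - measure \<nu> (cylinder p)\<bar> \<le> (\<integral>\<^sup>+\<omega>. gap t \<omega> \<partial>R)" for t
      unfolding gap_def using mu nu marginals
      by (intro measure_diff_le_expected_gap R.prob_space_axioms) auto
    ultimately have "ennreal \<bar>measure \<mu> (cylinder p) - measure \<nu> (cylinder p)\<bar> \<le> 0"
      by (intro LIMSEQ_le_const) auto
    then show "measure \<mu> (cylinder p) = measure \<nu> (cylinder p)"
      by simp
  qed fact+
qed

end
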